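(* Let $n\ge 1$ be an integer. Let $\{(m_i,M_i)\}_{i\in\mathbb{N}}$ be a sequence of pairs of coprime positive integers such that $m_i<M_i$ for every $i$ and $\lim_{i\to\infty} m_i=\infty$. Then $$\lim_{i\to\infty} p_{2n}\big(\mathbb{R}[X_{m_i,M_i}]\big)=\infty .$$
   Context: For a commutative ring $R$ with identity and a positive integer $n$, the $2n$-Pythagoras number $p_{2n}(R)$ is the smallest positive integer $g$ such that every element of $R$ which is a (finite) sum of $2n$th powers of elements of $R$ can be written as a sum of at most $g$ $2n$th powers of elements of $R$; if no such $g$ exists, $p_{2n}(R)=\infty$. The limit is taken in $\mathbb{N}\cup\{\infty\}$ (so some or all terms of the sequence may be $\infty$). For an algebraic subset $X\subset\mathbb{R}^d$, let $\mathcal{I}(X)\subset\mathbb{R}[x_1,\dots,x_d]$ be the ideal of all polynomials vanishing on $X$; the coordinate ring of $X$ is $\mathbb{R}[X]=\mathbb{R}[x_1,\dots,x_d]/\mathcal{I}(X)$. For coprime positive integers $m<M$, $X_{m,M}=\{(x,y)\in\mathbb{R}^2 : x^M=y^m\}$. *)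

theory Defs
  imports
    "HOL-Analysis.Finite_Cartesian_Product"
    "HOL-Library.Extended_Real"
    "HOL-Library.Numeral_Type"
    "HOL-Library.Poly_Mapping"
    "HOL-Algebra.QuotRing"
begin

definition power_sums :: "('a, 'b) ring_scheme \<Rightarrow> nat \<Rightarrow> nat \<Rightarrow> 'a set" where
  "power_sums R k g =
     {\<Oplus>\<^bsub>R\<^esub>i\<in>{..<l}. f i [^]\<^bsub>R\<^esub> k | l f. l \<le> g \<and> f \<in> {..<l} \<rightarrow> carrier R}"

text \<open>
  The \<open>2n\<close>-Pythagoras number of \<open>R\<close> is \<open>pythagoras_number R (2 * n)\<close>. In \<^typ>\<open>enat\<close> the
  infimum of the empty set is \<open>\<infinity>\<close>, and that of a nonempty set is its least element.
\<close>

definition pythagoras_number :: "('a, 'b) ring_scheme \<Rightarrow> nat \<Rightarrow> enat" where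
  "pythagoras_number R k =
     Inf {enat g | g. g > 0 \<and> (\<Union>l. power_sums R k l) \<subseteq> power_sums R k g}"


text \<open>
  A monomial is an exponent vector \<^typ>\<open>'d \<Rightarrow>\<^sub>0 nat\<close>. The variables are indexed by the finite
  type \<open>'d\<close> that also indexes the coordinates of \<^typ>\<open>real ^ 'd\<close>.
\<close>

type_synonym 'd real_mpoly = "('d \<Rightarrow>\<^sub>0 nat) \<Rightarrow>\<^sub>0 real"

definition real_mpoly_ring :: "('d::finite) real_mpoly ring" where
  "real_mpoly_ring = \<lparr>carrier = UNIV, mult = (*), one = 1, zero = 0, add = (+)\<rparr>"

definition eval_mpoly :: "('d::finite) real_mpoly \<Rightarrow> real ^ 'd \<Rightarrow> real" where
  "eval_mpoly p x =
     (\<Sum>a\<in>Poly_Mapping.keys p. Poly_Mapping.lookup p a * (\<Prod>i\<in>UNIV. (x $ i) ^ Poly_Mapping.lookup a i))"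

definition vanishing_ideal :: "(real ^ 'd) set \<Rightarrow> ('d::finite) real_mpoly set" where
  "vanishing_ideal X = {p. \<forall>x\<in>X. eval_mpoly p x = 0}"

definition coordinate_ring :: "(real ^ 'd) set \<Rightarrow> ('d::finite) real_mpoly set ring" where
  "coordinate_ring X = real_mpoly_ring Quot vanishing_ideal X"

definition monomial_curve :: "nat \<Rightarrow> nat \<Rightarrow> (real ^ 2) set" where
  "monomial_curve m M = {p. (p $ 1) ^ M = (p $ 2) ^ m}"


lemma eval_mpoly_superset:
  assumes "finite S" "Poly_Mapping.keys p \<subseteq> S"
  shows "eval_mpoly p x =
    (\<Sum>a\<in>S. Poly_Mapping.lookup p a * (\<Prod>i\<in>UNIV. (x $ i) ^ Poly_Mapping.lookup a i))"
  unfolding eval_mpoly_def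
  by (rule sum.mono_neutral_left) (use assms in \<open>auto simp: in_keys_iff\<close>)

lemma eval_mpoly_zero [simp]: "eval_mpoly 0 x = 0"
  by (simp add: eval_mpoly_def)

lemma eval_mpoly_add [simp]: "eval_mpoly (p + q) x = eval_mpoly p x + eval_mpoly q x"
proof -
  let ?S = "Poly_Mapping.keys p \<union> Poly_Mapping.keys q"
  have "Poly_Mapping.keys (p + q) \<subseteq> ?S" by (rule keys_add)
  then show ?thesis
    by (simp add: eval_mpoly_superset[of ?S] lookup_add distrib_right sum.distrib)
qed

lemma eval_mpoly_sum: "eval_mpoly (\<Sum>i\<in>A. f i) x = (\<Sum>i\<in>A. eval_mpoly (f i) x)"
  by (induction A rule: infinite_finite_induct) auto

lemma eval_mpoly_single [simp]:
  "eval_mpoly (Poly_Mapping.single a c) x = c * (\<Prod>i\<in>UNIV. (x $ i) ^ Poly_Mapping.lookup a i)"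
  by (cases "c = 0") (simp_all add: eval_mpoly_def)

lemma eval_mpoly_one [simp]: "eval_mpoly 1 x = 1"
  by (simp add: eval_mpoly_def)

lemma real_mpoly_sum_singles:
  "p = (\<Sum>a\<in>Poly_Mapping.keys p. Poly_Mapping.single a (Poly_Mapping.lookup p a))"
  by (rule poly_mapping_eqI)
    (simp add: lookup_sum lookup_single when_def in_keys_iff)

lemma eval_mpoly_mult [simp]: "eval_mpoly (p * q) x = eval_mpoly p x * eval_mpoly q x"
proof -
  have single: "eval_mpoly (Poly_Mapping.single a c * Poly_Mapping.single b d) x =
      eval_mpoly (Poly_Mapping.single a c) x * eval_mpoly (Poly_Mapping.single b d) x" for a b c d
    by (simp add: mult_single lookup_add power_add prod.distrib)
  show ?thesis
    by (subst real_mpoly_sum_singles[of p], subst real_mpoly_sum_singles[of q],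
        subst (2) real_mpoly_sum_singles[of p], subst (2) real_mpoly_sum_singles[of q])
      (simp only: eval_mpoly_sum sum_product single)
qed

lemma cring_real_mpoly_ring: "cring real_mpoly_ring"
proof (rule cringI)
  show "abelian_group real_mpoly_ring"
    by (rule abelian_groupI)
      (auto simp: real_mpoly_ring_def algebra_simps intro: exI[of _ "- x" for x])
  show "comm_monoid real_mpoly_ring"
    by (rule comm_monoidI) (auto simp: real_mpoly_ring_def algebra_simps)
qed (auto simp: real_mpoly_ring_def algebra_simps)

lemma ideal_vanishing_ideal: "ideal (vanishing_ideal X) real_mpoly_ring"
proof -
  interpret cring real_mpoly_ring by (rule cring_real_mpoly_ring)
  have "\<ominus>\<^bsub>real_mpoly_ring\<^esub> p = - p" for p
    by (rule minus_equality) (auto simp: real_mpoly_ring_def)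
  then have inv: "inv\<^bsub>add_monoid real_mpoly_ring\<^esub> p = - p" for p
    by (simp add: a_inv_def)
  have minus: "eval_mpoly (- p) x = - eval_mpoly p x" for p x
    using eval_mpoly_add[of p "- p" x] by simp
  have "subgroup (vanishing_ideal X) (add_monoid real_mpoly_ring)"
    by (rule subgroup.intro)
      (simp_all only: inv, auto simp: vanishing_ideal_def minus real_mpoly_ring_def)
  then show ?thesis
    by (intro idealI ring_axioms) (auto simp: vanishing_ideal_def real_mpoly_ring_def)
qed

lemma cring_coordinate_ring: "cring (coordinate_ring X)"
  unfolding coordinate_ring_def
  by (rule ideal.quotient_is_cring[OF ideal_vanishing_ideal cring_real_mpoly_ring])

end

theory Submission
  imports Defs "HOL-Analysis.Cartesian_Space" "HOL-Computational_Algebra.Polynomial"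
begin

text \<open>
  Let \<open>L\<^sub>0, \<dots>, L\<^sub>d\<close> be the Lagrange basis at the nodes \<open>0, \<dots>, d\<close> and put
  \<open>F = (\<Sum>l\<le>d. (L\<^sub>l(x) y\<^sup>l)\<^sup>2\<^sup>n)\<close>. If \<open>F = (\<Sum>i<g. G\<^sub>i\<^sup>2\<^sup>n)\<close> in \<open>\<real>[x, y]\<close>, then \<open>F(k, y) = y\<^sup>2\<^sup>n\<^sup>k\<close>
  forces \<open>G\<^sub>i(k, y) = b\<^sub>i\<^sub>k y\<^sup>k\<close>, and since \<open>G\<^sub>i\<close> has degree at most \<open>d\<close> in \<open>x\<close>, interpolation gives
  \<open>G\<^sub>i = (\<Sum>k\<le>d. b\<^sub>i\<^sub>k L\<^sub>k(x) y\<^sup>k)\<close>. Comparing values and \<open>x\<close>-derivatives at \<open>x = l\<close> yields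
  \<open>(\<Sum>i<g. b\<^sub>i\<^sub>l\<^sup>2\<^sup>n\<^sup>-\<^sup>1 b\<^sub>i\<^sub>k) = \<delta>\<^sub>k\<^sub>l\<close>, a matrix identity of rank \<open>d + 1\<close>, so \<open>g \<ge> d + 1\<close>.

  On the curve parametrized by \<open>(t\<^sup>m, t\<^sup>M)\<close>, monomials whose \<open>y\<close>-exponent is below \<open>m\<close> become
  distinct powers of \<open>t\<close>. For \<open>m > 4nd\<close>, the degree in \<open>t\<close> bounds the \<open>y\<close>-degree of all summands
  of a representation of \<open>F\<close> by \<open>2d\<close>, so any such representation on the curve already holds in \<open>\<real>[x, y]\<close>.
\<close>

section \<open>Linear algebra: a rank bound\<close>

text \<open>Gaussian elimination, by induction on the number \<open>g\<close> of equations;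
  \<open>K\<close> indexes the unknowns.\<close>

lemma underdetermined_system:
  fixes b :: "nat \<Rightarrow> 'k \<Rightarrow> 'a::field"
  assumes "finite K" "g < card K"
  shows "\<exists>v. (\<exists>k\<in>K. v k \<noteq> 0) \<and> (\<forall>i<g. (\<Sum>k\<in>K. b i k * v k) = 0)"
  using assms
proof (induction g arbitrary: K b)
  case 0
  then have "K \<noteq> {}" by auto
  then show ?case by (intro exI[of _ "\<lambda>_. 1"]) auto
next
  case (Suc g)
  show ?case
  proof (cases "\<forall>k\<in>K. b g k = 0")
    case True
    then show ?thesis
      using Suc.IH[of K b] Suc.prems by (auto simp: less_Suc_eq)
  next
    case False
    then obtain k0 where k0: "k0 \<in> K" "b g k0 \<noteq> 0" by auto
    let ?K = "K - {k0}"
    \<comment> \<open>Subtracting a multiple of equation \<open>g\<close> clears the unknown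
      \<open>k0\<close> from equation \<open>i\<close>.\<close>
    define c where "c i k = b i k - b i k0 * b g k / b g k0" for i k
    have "g < card ?K" using Suc.prems k0 by simp
    then obtain v where v: "\<exists>k\<in>?K. v k \<noteq> 0" "\<And>i. i < g \<Longrightarrow> (\<Sum>k\<in>?K. c i k * v k) = 0"
      using Suc.IH[of ?K c] Suc.prems by auto
    define s where "s = (\<Sum>k\<in>?K. b g k * v k)"
    \<comment> \<open>The value at \<open>k0\<close> solves equation \<open>g\<close>, and restores
      in the other equations what passing to \<open>c\<close> removed.\<close>
    define w where "w = v(k0 := - s / b g k0)"
    have w_sum: "(\<Sum>k\<in>K. b i k * w k) = b i k0 * (- s / b g k0) + (\<Sum>k\<in>?K. b i k * v k)" for i
      using Suc.prems k0 by (simp add: sum.remove[of K k0] w_def)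
    have "(\<Sum>k\<in>K. b i k * w k) = 0" if "i < Suc g" for i
    proof (cases "i = g")
      case True
      then show ?thesis using k0 unfolding w_sum by (simp add: s_def)
    next
      case False
      then have "0 = (\<Sum>k\<in>?K. c i k * v k)" using v(2)[of i] that by simp
      also have "\<dots> = (\<Sum>k\<in>?K. b i k * v k - b i k0 / b g k0 * (b g k * v k))"
        by (simp add: c_def algebra_simps)
      also have "\<dots> = (\<Sum>k\<in>?K. b i k * v k) - b i k0 / b g k0 * s"
        by (simp add: sum_subtractf s_def sum_distrib_left)
      finally show ?thesis unfolding w_sum by simp
    qed
    moreover have "\<exists>k\<in>K. w k \<noteq> 0" using v(1) by (auto simp: w_def)
    ultimately show ?thesis by blast
  qed
qed

text \<open>The identity matrix of size \<open>card K\<close> factors through dimension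
  \<open>g\<close>; for \<open>g < card K\<close> a nonzero kernel vector of \<open>b\<close> would
  be killed by the identity.\<close>

lemma biorthogonal_card_le:
  fixes b c :: "nat \<Rightarrow> 'k \<Rightarrow> 'a::field"
  assumes "finite K"
    and biorth: "\<And>k l. k \<in> K \<Longrightarrow> l \<in> K \<Longrightarrow> (\<Sum>i<g. c i l * b i k) = (if k = l then 1 else 0)"
  shows "card K \<le> g"
proof (rule ccontr)
  assume "\<not> card K \<le> g"
  then obtain v l where l: "l \<in> K" "v l \<noteq> 0"
    and v: "\<And>i. i < g \<Longrightarrow> (\<Sum>k\<in>K. b i k * v k) = 0"
    using underdetermined_system[of K g b] assms(1) by auto
  have "0 = (\<Sum>i<g. c i l * (\<Sum>k\<in>K. b i k * v k))" using v by simp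
  also have "\<dots> = (\<Sum>k\<in>K. (\<Sum>i<g. c i l * b i k) * v k)"
    by (simp add: sum_distrib_left sum_distrib_right mult.assoc) (rule sum.swap)
  also have "\<dots> = (\<Sum>k\<in>K. if k = l then v k else 0)"
    using biorth l by (intro sum.cong) auto
  also have "\<dots> = v l" using l assms(1) by simp
  finally show False using l by simp
qed

section \<open>Sums of even powers of univariate polynomials\<close>

text \<open>Polynomials are ordered by the sign of the leading coefficient of the difference. If
  \<open>p\<close> had the larger degree, \<open>q - p\<close> would inherit the negative leading
  coefficient of \<open>- p\<close>.\<close>

lemma degree_mono_nonneg:
  fixes p q :: "'a::linordered_idom poly"
  assumes "0 \<le> p" "p \<le> q"
  shows "degree p \<le> degree q"
proof (rule ccontr)
  assume "\<not> degree p \<le> degree q"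
  then have deg: "degree q < degree p" and "p \<noteq> 0" by auto
  have "degree (q - p) = degree p" "coeff (q - p) (degree p) = - coeff p (degree p)"
    using deg degree_add_eq_right[of q "- p"] by (simp_all add: coeff_eq_0)
  moreover have "0 < coeff p (degree p)"
    using assms \<open>p \<noteq> 0\<close> by (auto simp: less_eq_poly_def pos_poly_def)
  moreover have "q \<noteq> p" using deg by auto
  ultimately show False
    using assms by (auto simp: less_eq_poly_def pos_poly_def)
qed

text \<open>Even powers are nonnegative in this order, so each summand is at most the sum: leading
  terms cannot cancel.\<close>

lemma degree_le_of_even_power_sum:
  fixes f :: "'i \<Rightarrow> 'a::linordered_idom poly"
  assumes "finite A" "i \<in> A" "even k"
  shows "k * degree (f i) \<le> degree (\<Sum>i\<in>A. f i ^ k)"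
proof (cases "f i = 0")
  case False
  have "f i ^ k \<le> (\<Sum>i\<in>A. f i ^ k)"
    using assms by (intro member_le_sum) (auto simp: zero_le_even_power)
  then have "degree (f i ^ k) \<le> degree (\<Sum>i\<in>A. f i ^ k)"
    using assms by (intro degree_mono_nonneg) (auto simp: zero_le_even_power)
  then show ?thesis using False by (simp add: degree_power_eq)
qed simp

text \<open>Induction on \<open>k\<close>: the degree bound settles \<open>k = 0\<close>. Otherwise
  the sum vanishes at 0, hence so does every \<open>f i\<close>, and dividing each by the variable
  lowers \<open>k\<close> by one.\<close>

lemma even_power_sum_eq_monom:
  fixes f :: "'i \<Rightarrow> real poly"
  assumes "finite A" "n \<ge> 1" "(\<Sum>i\<in>A. f i ^ (2 * n)) = monom 1 (2 * n * k)"
  shows "\<forall>i\<in>A. \<exists>b. f i = monom b k"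
  using assms(3)
proof (induction k arbitrary: f)
  case 0
  have "\<exists>b. f i = monom b 0" if "i \<in> A" for i
  proof -
    have "degree (f i) = 0"
      using degree_le_of_even_power_sum[OF assms(1) that, of "2 * n" f] 0 assms(2)
      by (simp add: degree_monom_eq)
    then show ?thesis by (metis degree_eq_zeroE monom_0)
  qed
  then show ?case by blast
next
  case (Suc k)
  have "(\<Sum>i\<in>A. poly (f i) 0 ^ (2 * n)) = 0"
    using arg_cong[OF Suc.prems, of "\<lambda>p. poly p 0"] assms(2)
    by (simp add: poly_sum poly_monom)
  then have "\<forall>i\<in>A. poly (f i) 0 ^ (2 * n) = 0"
    by (subst (asm) sum_nonneg_eq_0_iff) (auto simp: assms(1) zero_le_even_power)
  then have "\<forall>i\<in>A. poly (f i) 0 = 0" using assms(2) by simp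
  then have "\<forall>i\<in>A. \<exists>r. f i = monom 1 1 * r"
    by (metis dvdE minus_zero monom_0 monom_Suc poly_eq_0_iff_dvd One_nat_def one_pCons)
  then obtain r where r: "\<And>i. i \<in> A \<Longrightarrow> f i = monom 1 1 * r i" by metis
  have "monom 1 (2 * n) * (\<Sum>i\<in>A. r i ^ (2 * n)) = (\<Sum>i\<in>A. f i ^ (2 * n))"
    by (simp add: r power_mult_distrib monom_power sum_distrib_left)
  also have "\<dots> = monom 1 (2 * n) * monom 1 (2 * n * k)"
    by (simp add: Suc.prems mult_monom)
  finally have "(\<Sum>i\<in>A. r i ^ (2 * n)) = monom 1 (2 * n * k)"
    by simp
  from Suc.IH[OF this] show ?case
    using r by (fastforce simp: mult_monom)
qed

section \<open>Lagrange interpolation at the nodes 0, ..., d\<close>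

definition lagrange_basis :: "nat \<Rightarrow> nat \<Rightarrow> real poly" where
  "lagrange_basis d k =
     smult (inverse (\<Prod>j\<in>{..d} - {k}. real k - real j)) (\<Prod>j\<in>{..d} - {k}. [:- real j, 1:])"

lemma poly_lagrange_basis:
  assumes "k \<le> d" "l \<le> d"
  shows "poly (lagrange_basis d k) (real l) = (if k = l then 1 else 0)"
  using assms by (auto simp: lagrange_basis_def poly_prod)

lemma degree_lagrange_basis: "k \<le> d \<Longrightarrow> degree (lagrange_basis d k) \<le> d"
  using degree_prod_sum_le[of "{..d} - {k}" "\<lambda>j. [:- real j, 1:]"]
  by (simp add: lagrange_basis_def)

text \<open>The node \<open>l\<close> is a simple zero: once its linear factor is split off, the
  derivative there is a nonzero multiple of the product of the other factors.\<close>

lemma pderiv_lagrange_basis_nonzero: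
  assumes "k \<le> d" "l \<le> d" "k \<noteq> l"
  shows "poly (pderiv (lagrange_basis d k)) (real l) \<noteq> 0"
proof -
  have "(\<Prod>j\<in>{..d} - {k}. [:- real j, 1:]) =
      [:- real l, 1:] * (\<Prod>j\<in>{..d} - {k} - {l}. [:- real j, 1:])"
    using assms by (intro prod.remove) auto
  then show ?thesis
    by (simp add: lagrange_basis_def pderiv_smult pderiv_mult pderiv_pCons poly_prod
        del: mult_pCons_left)
qed

lemma lagrange_interpolation:
  assumes "degree p \<le> d"
  shows "p = (\<Sum>k\<le>d. smult (poly p (real k)) (lagrange_basis d k))"
proof (rule poly_eqI_degree[where A = "real ` {..d}"])
  fix x assume "x \<in> real ` {..d}"
  then obtain l where l: "l \<le> d" "x = real l" by auto
  have "(\<Sum>k\<le>d. poly p (real k) * poly (lagrange_basis d k) (real l)) =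
      (\<Sum>k\<le>d. if k = l then poly p (real k) else 0)"
    using l by (intro sum.cong) (auto simp: poly_lagrange_basis)
  with l show "poly p x = poly (\<Sum>k\<le>d. smult (poly p (real k)) (lagrange_basis d k)) x"
    by (simp add: poly_sum)
next
  have card: "card (real ` {..d}) = Suc d" by (subst card_image) auto
  show "degree p < card (real ` {..d})" using assms card by simp
  have "degree (\<Sum>k\<le>d. smult (poly p (real k)) (lagrange_basis d k)) \<le> d"
    by (intro degree_sum_le) (auto intro: order.trans[OF degree_smult_le] degree_lagrange_basis)
  then show "degree (\<Sum>k\<le>d. smult (poly p (real k)) (lagrange_basis d k)) < card (real ` {..d})"
    using card by simp
qed

section \<open>Length of power sum representations in the plane\<close>

text \<open>A bivariate polynomial is a polynomial in \<open>y\<close> whose coefficients are polynomials in \<open>x\<close>.\<close>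

abbreviation eval2 :: "real poly poly \<Rightarrow> real \<Rightarrow> real \<Rightarrow> real" where
  "eval2 G x y \<equiv> poly (poly G [:y:]) x"

lemma eval2_inner_fixed: "\<exists>q. \<forall>y. poly q y = eval2 G x y"
proof (induction G)
  case (pCons a G)
  then obtain q where "\<forall>y. poly q y = eval2 G x y" by auto
  then show ?case by (intro exI[of _ "pCons (poly a x) q"]) simp
qed (auto intro: exI[of _ 0])

lemma lagrange_power_sum_length:
  fixes G :: "nat \<Rightarrow> real poly poly"
  assumes n: "n \<ge> 1"
    and eq: "(\<Sum>i<g. G i ^ (2 * n)) = (\<Sum>l\<le>d. monom (lagrange_basis d l) l ^ (2 * n))"
  shows "d < g"
proof -
  let ?L = "lagrange_basis d"
  \<comment> \<open>Only \<open>y\<close> is specialized, so that degrees and derivatives in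
    \<open>x\<close> remain available.\<close>
  have eqy: "(\<Sum>i<g. poly (G i) [:y:] ^ (2 * n)) = (\<Sum>l\<le>d. smult (y ^ l) (?L l) ^ (2 * n))" for y
    using arg_cong[OF eq, of "\<lambda>p. poly p [:y:]"]
    by (simp add: poly_sum poly_monom poly_const_pow)
  have deg: "degree (poly (G i) [:y:]) \<le> d" if "i < g" for i y
  proof -
    have "degree (\<Sum>l\<le>d. smult (y ^ l) (?L l) ^ (2 * n)) \<le> 2 * n * d"
    proof (intro degree_sum_le)
      fix l assume "l \<in> {..d}"
      then have "degree (smult (y ^ l) (?L l)) \<le> d"
        by (auto intro: order.trans[OF degree_smult_le] degree_lagrange_basis)
      then show "degree (smult (y ^ l) (?L l) ^ (2 * n)) \<le> 2 * n * d"
        by (rule order.trans[OF degree_power_le, OF order.trans[OF mult_le_mono1]]) simp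
    qed simp
    moreover have "2 * n * degree (poly (G i) [:y:]) \<le> degree (\<Sum>i<g. poly (G i) [:y:] ^ (2 * n))"
      using that by (intro degree_le_of_even_power_sum) auto
    ultimately have "2 * n * degree (poly (G i) [:y:]) \<le> 2 * n * d" unfolding eqy by linarith
    then show ?thesis using n by simp
  qed
  \<comment> \<open>At \<open>x = k\<close> only the summand \<open>l = k\<close> survives on the
    right, leaving a single power of \<open>y\<close>.\<close>
  have "\<exists>b. \<forall>y. eval2 (G i) (real k) y = b * y ^ k" if "i < g" "k \<le> d" for i k
  proof -
    have "\<forall>i. \<exists>q. \<forall>y. poly q y = eval2 (G i) (real k) y"
      using eval2_inner_fixed by blast
    then obtain q where q: "\<And>i y. poly (q i) y = eval2 (G i) (real k) y"
      by metis
    have "(\<Sum>i<g. q i ^ (2 * n)) = monom 1 (2 * n * k)"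
    proof (rule poly_ext)
      fix y
      have "(\<Sum>l\<le>d. (y ^ l * poly (?L l) (real k)) ^ (2 * n)) =
          (\<Sum>l\<le>d. if l = k then y ^ (2 * n * k) else 0)"
        using that n by (intro sum.cong) (auto simp: poly_lagrange_basis mult.commute simp flip: power_mult)
      then show "poly (\<Sum>i<g. q i ^ (2 * n)) y = poly (monom 1 (2 * n * k)) y"
        using arg_cong[OF eqy[of y], of "\<lambda>p. poly p (real k)"] that
        by (simp add: q poly_sum poly_monom)
    qed
    then have "\<forall>i\<in>{..<g}. \<exists>b. q i = monom b k"
      using n by (intro even_power_sum_eq_monom) auto
    with that obtain b where "q i = monom b k" by blast
    then show ?thesis using q[of i] by (metis poly_monom)
  qed
  then obtain b where b: "\<And>i k y. i < g \<Longrightarrow> k \<le> d \<Longrightarrow> eval2 (G i) (real k) y = b i k * y ^ k"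
    by metis
  have G: "poly (G i) [:y:] = (\<Sum>k\<le>d. smult (b i k * y ^ k) (?L k))" if "i < g" for i y
    using lagrange_interpolation[OF deg[OF that, of y]] b[OF that] by simp
  define D where "D k l = poly (pderiv (?L k)) (real l)" for k l
  define C where "C k l = (\<Sum>i<g. b i l ^ (2 * n - 1) * b i k)" for k l
  have diag: "C l l = 1" if "l \<le> d" for l
  proof -
    have "(\<Sum>k\<le>d. poly (?L k) (real l) ^ (2 * n)) = (\<Sum>k\<le>d. if k = l then 1 else 0)"
      using that n by (intro sum.cong) (auto simp: poly_lagrange_basis)
    then have "(\<Sum>i<g. b i l ^ (2 * n)) = 1"
      using arg_cong[OF eqy[of 1], of "\<lambda>p. poly p (real l)"] b[of _ l 1] that
      by (simp add: poly_sum)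
    moreover have "b i l ^ (2 * n) = b i l ^ (2 * n - 1) * b i l" for i
      using n power_minus_mult[of "2 * n" "b i l"] by simp
    ultimately show ?thesis by (simp add: C_def)
  qed
  have offdiag: "C k l = 0" if "k \<le> d" "l \<le> d" "k \<noteq> l" for k l
  proof -
    \<comment> \<open>The form \<open>Suc N\<close> suits the power rule, and \<open>N > 0\<close>
      makes the terms with \<open>k\<close> different from \<open>l\<close> vanish on the
      right.\<close>
    define N where "N = 2 * n - 1"
    have N: "2 * n = Suc N" "N > 0" using n by (auto simp: N_def)
    define P where "P = (\<Sum>k\<le>d. monom (D k l * C k l) k)"
    \<comment> \<open>This is the \<open>x\<close>-derivative of \<open>eqy\<close> at
      \<open>x = l\<close>, divided by \<open>2 * n\<close> and read as an identity in
      \<open>y\<close>. Cancelling the common power of \<open>y\<close> allows coefficients to be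
      compared.\<close>
    have "P * monom 1 (N * l) = monom (D l l) l * monom 1 (N * l)"
    proof (rule poly_ext)
      fix y
      have "(\<Sum>i<g. (1 + real N) * ((b i l * y ^ l) ^ N * (\<Sum>k\<le>d. b i k * y ^ k * D k l))) =
          (\<Sum>k\<le>d. (1 + real N) * ((y ^ k * poly (?L k) (real l)) ^ N * (y ^ k * D k l)))"
        using arg_cong[OF eqy[of y], of "\<lambda>p. poly (pderiv p) (real l)"] b[OF _ that(2)]
        by (simp add: N higher_pderiv_sum[of 1, simplified] pderiv_power_Suc poly_sum G
            pderiv_smult D_def mult.assoc mult.left_commute del: power_Suc sum.lessThan_Suc)
      also have "\<dots> = (\<Sum>k\<le>d. if k = l then (1 + real N) * (D l l * y ^ l * y ^ (N * l)) else 0)"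
        using that N by (intro sum.cong)
          (auto simp: poly_lagrange_basis mult.commute simp flip: power_mult)
      also have "\<dots> = (1 + real N) * (D l l * y ^ l * y ^ (N * l))" using that by simp
      finally have "(\<Sum>i<g. (b i l * y ^ l) ^ N * (\<Sum>k\<le>d. b i k * y ^ k * D k l)) =
          D l l * y ^ l * y ^ (N * l)"
        by (simp flip: sum_distrib_left)
      moreover have "(\<Sum>i<g. (b i l * y ^ l) ^ N * (\<Sum>k\<le>d. b i k * y ^ k * D k l)) =
          (\<Sum>k\<le>d. D k l * C k l * y ^ k) * y ^ (N * l)"
        unfolding C_def N_def[symmetric] sum_distrib_left sum_distrib_right
        by (subst sum.swap) (intro sum.cong refl, simp add: power_mult_distrib mult_ac flip: power_mult)
      ultimately show "poly (P * monom 1 (N * l)) y = poly (monom (D l l) l * monom 1 (N * l)) y"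
        by (simp add: P_def poly_sum poly_monom)
    qed
    then have "P = monom (D l l) l" by simp
    then have "coeff P k = 0" using that by (simp add: coeff_monom)
    moreover have "coeff P k = D k l * C k l"
      using that by (simp add: P_def coeff_sum coeff_monom)
    ultimately show ?thesis
      using pderiv_lagrange_basis_nonzero[OF that] by (simp add: D_def)
  qed
  have "card {..d} \<le> g"
    by (rule biorthogonal_card_le[where c = "\<lambda>i l. b i l ^ (2 * n - 1)" and b = b])
      (use diag offdiag in \<open>auto simp: C_def\<close>)
  then show ?thesis by simp
qed

section \<open>Restriction of polynomials to the curve\<close>

text \<open>\<open>M\<close> is invertible modulo \<open>m\<close>, so \<open>b\<close> is
  determined modulo \<open>m\<close>, hence exactly by its bound. Thus monomials of
  \<open>y\<close>-degree below \<open>m\<close> restrict to distinct powers of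
  \<open>t\<close>.\<close>

lemma coprime_combination_inject:
  fixes a b :: nat
  assumes "coprime m M" "b < m" "b' < m" "m * a + M * b = m * a' + M * b'"
  shows "a = a' \<and> b = b'"
proof -
  have *: "b = b'" if "b \<le> b'" "b' < m" "m * a + M * b = m * a' + M * b'" for a a' b b' :: nat
  proof -
    have "M * (b' - b) = m * a - m * a'" using that by (simp add: diff_mult_distrib2)
    then have "m dvd M * (b' - b)" by (metis diff_mult_distrib2 dvd_triv_left)
    then have "m dvd b' - b" using assms(1) by (simp add: coprime_dvd_mult_right_iff)
    then show ?thesis using that by (auto dest: dvd_imp_le)
  qed
  have "b = b'"
    using *[of b b' a a'] *[of b' b a' a] assms by (cases "b \<le> b'") auto
  then show ?thesis using assms by auto
qed

lemma eval2_curve_polynomial: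
  assumes "coprime m M" "degree G < m"
  obtains q where "\<And>t. poly q t = eval2 G (t ^ m) (t ^ M)"
    "G \<noteq> 0 \<Longrightarrow> q \<noteq> 0" "M * degree G \<le> degree q"
proof -
  define c where "c b a = coeff (coeff G b) a" for b a
  define q where "q = (\<Sum>b\<le>degree G. \<Sum>a\<le>degree (coeff G b). monom (c b a) (m * a + M * b))"
  \<comment> \<open>The exponent of the monomial of \<open>G\<close> leading first in
    \<open>y\<close>, then in \<open>x\<close>. It need not be the degree of \<open>q\<close>, but
    no other monomial contributes to it, so its coefficient survives.\<close>
  define s where "s = m * degree (lead_coeff G) + M * degree G"
  have s_eq: "m * a + M * b = s \<longleftrightarrow> a = degree (lead_coeff G) \<and> b = degree G" if "b \<le> degree G" for a b
    using coprime_combination_inject[OF assms(1), of b "degree G" a "degree (lead_coeff G)"]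
      assms(2) that by (auto simp: s_def)
  have "coeff q s = (\<Sum>b\<le>degree G. \<Sum>a\<le>degree (coeff G b).
      if a = degree (lead_coeff G) \<and> b = degree G then c b a else 0)"
    unfolding q_def coeff_sum coeff_monom by (intro sum.cong refl) (simp add: s_eq)
  also have "\<dots> = (\<Sum>b\<le>degree G. if b = degree G then lead_coeff (lead_coeff G) else 0)"
    by (intro sum.cong refl) (auto simp: c_def)
  finally have coeff: "coeff q s = lead_coeff (lead_coeff G)" by simp
  show ?thesis
  proof (rule that)
    show "poly q t = eval2 G (t ^ m) (t ^ M)" for t
    proof -
      have "eval2 G (t ^ m) (t ^ M) = (\<Sum>b\<le>degree G. poly (coeff G b) (t ^ m) * t ^ (M * b))"
        by (simp add: poly_altdef[of G] poly_sum poly_power power_mult del: poly_const_pow)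
      also have "\<dots> = poly q t"
        by (simp add: poly_altdef[of "coeff G _"] q_def poly_sum poly_monom c_def power_mult
            power_add sum_distrib_right mult.assoc)
      finally show ?thesis ..
    qed
    show "q \<noteq> 0" if "G \<noteq> 0" using coeff that by auto
    show "M * degree G \<le> degree q"
    proof (cases "G = 0")
      case False
      then have "s \<le> degree q" using coeff by (intro le_degree) simp
      then show ?thesis by (simp add: s_def)
    qed simp
  qed
qed

definition curve_point :: "nat \<Rightarrow> nat \<Rightarrow> real \<Rightarrow> real ^ 2" where
  "curve_point m M t = (\<chi> i. if i = 1 then t ^ m else t ^ M)"

lemma curve_point_in_monomial_curve: "curve_point m M t \<in> monomial_curve m M"
  by (simp add: curve_point_def monomial_curve_def mult.commute flip: power_mult)

lemma eval_mpoly_two: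
  fixes x :: "real ^ 2"
  shows "eval_mpoly p x =
    (\<Sum>a\<in>Poly_Mapping.keys p. Poly_Mapping.lookup p a *
      ((x $ 1) ^ Poly_Mapping.lookup a 1 * (x $ 2) ^ Poly_Mapping.lookup a 2))"
  unfolding eval_mpoly_def by (intro sum.cong refl) (simp add: UNIV_2)

text \<open>The curve equation replaces each \<open>m\<close>-th power of \<open>y\<close> by the
  \<open>M\<close>-th power of \<open>x\<close>, which brings all \<open>y\<close>-exponents below
  \<open>m\<close>.\<close>

lemma eval_mpoly_curve_eq_eval2:
  assumes "0 < m"
  obtains G where "degree G < m"
    "\<And>t. eval_mpoly p (curve_point m M t) = eval2 G (t ^ m) (t ^ M)"
proof -
  let ?a = "\<lambda>e. Poly_Mapping.lookup e (1::2)" and ?b = "\<lambda>e. Poly_Mapping.lookup e (2::2)"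
  define G where "G = (\<Sum>e\<in>Poly_Mapping.keys p.
    monom (monom (Poly_Mapping.lookup p e) (?a e + M * (?b e div m))) (?b e mod m))"
  show ?thesis
  proof (rule that)
    show "degree G < m"
      unfolding G_def using assms
      by (intro degree_sum_less) (auto intro: le_less_trans[OF degree_monom_le])
    fix t :: real
    have reduce: "(t ^ m) ^ a * (t ^ M) ^ b = (t ^ m) ^ (a + M * (b div m)) * (t ^ M) ^ (b mod m)" for a b
    proof -
      have "M * b = M * (m * (b div m) + b mod m)" by simp
      then have "m * a + M * b = m * (a + M * (b div m)) + M * (b mod m)"
        by (simp only: algebra_simps)
      then show ?thesis by (simp only: flip: power_mult power_add)
    qed
    show "eval_mpoly p (curve_point m M t) = eval2 G (t ^ m) (t ^ M)"
      unfolding eval_mpoly_two G_def poly_sum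
      by (intro sum.cong refl, simp add: curve_point_def poly_monom poly_const_pow)
        (subst reduce, simp add: mult_ac)
  qed
qed

lemma exists_mpoly_separated:
  fixes q :: "real poly"
  shows "\<exists>p :: 2 real_mpoly. \<forall>x. eval_mpoly p x = poly q (x $ 1) * (x $ 2) ^ l"
proof
  let ?e = "\<lambda>a. Poly_Mapping.single (1::2) a + Poly_Mapping.single 2 l"
  show "\<forall>x. eval_mpoly (\<Sum>a\<le>degree q. Poly_Mapping.single (?e a) (coeff q a)) x =
      poly q (x $ 1) * (x $ 2) ^ l"
    by (simp add: eval_mpoly_sum UNIV_2 lookup_add lookup_single poly_altdef sum_distrib_right
        mult.assoc)
qed

text \<open>Absence of cancellation bounds the \<open>t\<close>-degree of each summand by
  \<open>2 * d * M\<close>, hence its \<open>y\<close>-degree by \<open>2 * d\<close>. Both power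
  sums then have \<open>y\<close>-degree at most \<open>4 * n * d < m\<close>, where restriction to
  the curve is injective.\<close>

lemma power_sum_lifts_to_plane:
  fixes P :: "nat \<Rightarrow> 2 real_mpoly" and H :: "nat \<Rightarrow> real poly poly"
  assumes n: "n \<ge> 1" and m: "4 * n * d < m" "m < M" "coprime m M"
    and H: "\<And>l. l \<le> d \<Longrightarrow> degree (H l) \<le> d"
      "\<And>l b. l \<le> d \<Longrightarrow> degree (coeff (H l) b) \<le> d"
    and eq: "\<And>t. (\<Sum>i<g. eval_mpoly (P i) (curve_point m M t) ^ (2 * n)) =
      (\<Sum>l\<le>d. eval2 (H l) (t ^ m) (t ^ M) ^ (2 * n))"
  obtains G where "(\<Sum>i<g. G i ^ (2 * n)) = (\<Sum>l\<le>d. H l ^ (2 * n))"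
proof -
  have "0 < m" using m by simp
  have "\<exists>G. degree G < m \<and> (\<forall>t. eval_mpoly (P i) (curve_point m M t) = eval2 G (t ^ m) (t ^ M))" for i
    using eval_mpoly_curve_eq_eval2[OF \<open>0 < m\<close>] by metis
  then obtain G where G: "\<And>i. degree (G i) < m"
    "\<And>i t. eval_mpoly (P i) (curve_point m M t) = eval2 (G i) (t ^ m) (t ^ M)"
    by metis
  have "\<exists>q. (\<forall>t. poly q t = eval2 (G i) (t ^ m) (t ^ M)) \<and> M * degree (G i) \<le> degree q" for i
    using eval2_curve_polynomial[OF m(3) G(1)[of i]] by metis
  then obtain q where q: "\<And>i t. poly (q i) t = eval2 (G i) (t ^ m) (t ^ M)"
    "\<And>i. M * degree (G i) \<le> degree (q i)"
    by metis
  define h where "h l = (\<Sum>b\<le>d. pcompose (coeff (H l) b) (monom 1 m) * monom 1 (M * b))" for l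
  have h: "poly (h l) t = eval2 (H l) (t ^ m) (t ^ M)" if "l \<le> d" for l t
    using arg_cong[OF poly_as_sum_of_monoms'[OF H(1)[OF that]], of "\<lambda>p. eval2 p (t ^ m) (t ^ M)"]
    by (simp add: h_def poly_sum poly_monom poly_pcompose poly_const_pow power_mult)
      (simp only: mult.commute)
  have deg_h: "degree (h l) \<le> 2 * d * M" if "l \<le> d" for l
    unfolding h_def
  proof (intro degree_sum_le)
    fix b assume b: "b \<in> {..d}"
    have "degree (pcompose (coeff (H l) b) (monom 1 m)) \<le> d * m"
      using H(2)[OF that, of b] by (simp add: degree_pcompose degree_monom_eq)
    then have "degree (pcompose (coeff (H l) b) (monom 1 m) * monom 1 (M * b)) \<le> d * m + M * b"
      using degree_mult_le[of "pcompose (coeff (H l) b) (monom 1 m)" "monom 1 (M * b)"]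
      by (simp add: degree_monom_eq)
    \<comment> \<open>Here \<open>m < M\<close> absorbs the contribution of \<open>x\<close>, giving
      a bound proportional to \<open>M\<close> alone.\<close>
    also have "\<dots> \<le> d * M + M * d" using b m by (intro add_mono mult_mono) auto
    finally show "degree (pcompose (coeff (H l) b) (monom 1 m) * monom 1 (M * b)) \<le> 2 * d * M"
      by (simp add: mult.commute)
  qed simp
  have q_sum: "(\<Sum>i<g. q i ^ (2 * n)) = (\<Sum>l\<le>d. h l ^ (2 * n))"
    using eq by (intro poly_ext) (simp add: poly_sum q h G)
  have deg_G: "degree (G i) \<le> 2 * d" if "i < g" for i
  proof -
    have "2 * n * degree (q i) \<le> degree (\<Sum>l\<le>d. h l ^ (2 * n))"
      using degree_le_of_even_power_sum[of "{..<g}" i "2 * n" q] that by (simp add: q_sum)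
    also have "\<dots> \<le> 2 * n * (2 * d * M)"
    proof (intro degree_sum_le)
      fix l assume "l \<in> {..d}"
      then show "degree (h l ^ (2 * n)) \<le> 2 * n * (2 * d * M)"
        using deg_h[of l]
        by (intro order.trans[OF degree_power_le]) (simp add: mult.commute)
    qed simp
    finally have "degree (q i) \<le> 2 * d * M" by (rule mult_left_le_imp_le) (use n in simp)
    then have "M * degree (G i) \<le> M * (2 * d)"
      using order.trans[OF q(2)[of i]] by (simp only: mult.commute)
    then show ?thesis by (rule mult_left_le_imp_le) (use m in simp)
  qed
  define K where "K = (\<Sum>i<g. G i ^ (2 * n)) - (\<Sum>l\<le>d. H l ^ (2 * n))"
  have pow: "degree (p ^ (2 * n)) < m" if "degree p \<le> 2 * d" for p :: "real poly poly"
  proof -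
    have "degree (p ^ (2 * n)) \<le> degree p * (2 * n)" by (rule degree_power_le)
    also have "\<dots> \<le> 2 * d * (2 * n)" using that by (rule mult_le_mono1)
    also have "\<dots> < m" using m by (simp add: mult_ac)
    finally show ?thesis .
  qed
  have "degree (H l) \<le> 2 * d" if "l \<le> d" for l using H(1)[OF that] by simp
  then have "degree (\<Sum>l\<le>d. H l ^ (2 * n)) < m"
    using \<open>0 < m\<close> by (intro degree_sum_less pow) auto
  moreover have "degree (\<Sum>i<g. G i ^ (2 * n)) < m"
    using deg_G \<open>0 < m\<close> by (intro degree_sum_less pow) auto
  ultimately have "degree K < m"
    unfolding K_def by (intro degree_diff_less)
  then obtain r where r: "\<And>t. poly r t = eval2 K (t ^ m) (t ^ M)" "K \<noteq> 0 \<Longrightarrow> r \<noteq> 0"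
    using eval2_curve_polynomial[OF m(3)] by metis
  have "r = 0"
    using eq by (intro poly_ext) (simp add: r K_def poly_sum G)
  then have "K = 0" using r by blast
  then show ?thesis using that[of G] by (simp add: K_def)
qed

section \<open>Computing in the coordinate ring with representatives\<close>

abbreviation residue :: "(real ^ 'd) set \<Rightarrow> ('d::finite) real_mpoly \<Rightarrow> 'd real_mpoly set" where
  "residue X p \<equiv> vanishing_ideal X +>\<^bsub>real_mpoly_ring\<^esub> p"

lemma residue_in_carrier: "residue X p \<in> carrier (coordinate_ring X)"
  by (auto simp: coordinate_ring_def FactRing_def A_RCOSETS_defs a_r_coset_def real_mpoly_ring_def)

lemma carrier_coordinate_ringD:
  "C \<in> carrier (coordinate_ring X) \<Longrightarrow> \<exists>p. C = residue X p"
  by (auto simp: coordinate_ring_def FactRing_def A_RCOSETS_defs a_r_coset_def)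

lemma eval_mpoly_eq_of_residue_eq:
  assumes "residue X p = residue X q" "x \<in> X"
  shows "eval_mpoly p x = eval_mpoly q x"
proof -
  have coset: "residue X r = (\<lambda>i. i + r) ` vanishing_ideal X" for r
    by (auto simp: a_r_coset_def r_coset_def real_mpoly_ring_def)
  have "p \<in> residue X p"
    unfolding coset by (rule image_eqI[of _ _ 0]) (simp_all add: vanishing_ideal_def)
  then obtain i where "i \<in> vanishing_ideal X" "p = i + q"
    unfolding assms(1) unfolding coset by (rule imageE)
  then show ?thesis using assms(2) by (simp add: vanishing_ideal_def)
qed

lemma real_mpoly_ring_nat_pow: "p [^]\<^bsub>real_mpoly_ring\<^esub> (k::nat) = p ^ k"
proof -
  interpret cring real_mpoly_ring by (rule cring_real_mpoly_ring)
  have "x \<otimes>\<^bsub>real_mpoly_ring\<^esub> y = x * y" "\<one>\<^bsub>real_mpoly_ring\<^esub> = 1" for x y :: "'a real_mpoly"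
    by (simp_all add: real_mpoly_ring_def)
  note simps = this
  show ?thesis by (induction k) (simp_all add: simps mult.commute)
qed

lemma real_mpoly_ring_finsum: "finite A \<Longrightarrow> finsum real_mpoly_ring f A = sum f A"
proof (induction A rule: finite_induct)
  case empty
  interpret cring real_mpoly_ring by (rule cring_real_mpoly_ring)
  show ?case using finsum_empty by (simp add: real_mpoly_ring_def)
next
  case (insert a A)
  interpret cring real_mpoly_ring by (rule cring_real_mpoly_ring)
  have "x \<oplus>\<^bsub>real_mpoly_ring\<^esub> y = x + y" "x \<in> carrier real_mpoly_ring" for x y :: "'b real_mpoly"
    by (simp_all add: real_mpoly_ring_def)
  then show ?case using insert by (simp add: finsum_insert)
qed

text \<open>The quotient map is a ring homomorphism; this moves power sums of classes to ordinary
  polynomial arithmetic on representatives.\<close>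

lemma residue_power_sum:
  fixes p :: "'i \<Rightarrow> ('d::finite) real_mpoly"
  assumes "finite A"
  shows "(\<Oplus>\<^bsub>coordinate_ring X\<^esub>i\<in>A. residue X (p i) [^]\<^bsub>coordinate_ring X\<^esub> (k::nat)) =
    residue X (\<Sum>i\<in>A. p i ^ k)"
proof -
  interpret hom: ring_hom_cring real_mpoly_ring "coordinate_ring X" "residue X"
    unfolding coordinate_ring_def
    by (rule ideal.rcos_ring_hom_cring[OF ideal_vanishing_ideal cring_real_mpoly_ring])
  have carrier: "q \<in> carrier real_mpoly_ring" for q :: "'d real_mpoly"
    by (simp add: real_mpoly_ring_def)
  have pow: "residue X q [^]\<^bsub>coordinate_ring X\<^esub> k = residue X (q ^ k)" for q
    unfolding real_mpoly_ring_nat_pow[symmetric] unfolding coordinate_ring_def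
    by (rule ring_hom_ring.hom_nat_pow[OF
          ideal.rcos_ring_hom_ring[OF ideal_vanishing_ideal], symmetric, OF carrier])
  have "residue X (finsum real_mpoly_ring (\<lambda>i. p i ^ k) A) =
      finsum (coordinate_ring X) (residue X \<circ> (\<lambda>i. p i ^ k)) A"
    by (rule hom.hom_finsum) (simp add: carrier)
  then show ?thesis by (simp add: pow real_mpoly_ring_finsum assms comp_def)
qed

lemma eval_mpoly_power: "eval_mpoly (p ^ k) x = eval_mpoly p x ^ k"
  by (induction k) simp_all

section \<open>The lower bound and the limit\<close>

lemma pythagoras_bound_monomial_curve:
  assumes n: "n \<ge> 1" and m: "4 * n * d < m" "m < M" "coprime m M"
    and g: "(\<Union>l. power_sums (coordinate_ring (monomial_curve m M)) (2 * n) l) \<subseteq>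
      power_sums (coordinate_ring (monomial_curve m M)) (2 * n) g"
  shows "d < g"
proof -
  let ?X = "monomial_curve m M"
  let ?R = "coordinate_ring ?X"
  have "\<forall>l. \<exists>p :: 2 real_mpoly. \<forall>x. eval_mpoly p x = poly (lagrange_basis d l) (x $ 1) * (x $ 2) ^ l"
    using exists_mpoly_separated by blast
  then obtain h :: "nat \<Rightarrow> 2 real_mpoly" where
    h: "\<And>l x. eval_mpoly (h l) x = poly (lagrange_basis d l) (x $ 1) * (x $ 2) ^ l"
    by metis
  let ?F = "\<Oplus>\<^bsub>?R\<^esub>l\<in>{..<Suc d}. residue ?X (h l) [^]\<^bsub>?R\<^esub> (2 * n)"
  have "?F \<in> power_sums ?R (2 * n) (Suc d)"
    unfolding power_sums_def
    by (intro CollectI exI[of _ "Suc d"] exI[of _ "\<lambda>l. residue ?X (h l)"])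
      (simp add: residue_in_carrier)
  then have "?F \<in> power_sums ?R (2 * n) g" using g by blast
  \<comment> \<open>The actual length \<open>k\<close> may be below \<open>g\<close>; the bound
    \<open>d < k\<close> is proved for it.\<close>
  then obtain k f where k: "k \<le> g" "f \<in> {..<k} \<rightarrow> carrier ?R"
    and F: "?F = (\<Oplus>\<^bsub>?R\<^esub>i\<in>{..<k}. f i [^]\<^bsub>?R\<^esub> (2 * n))"
    unfolding power_sums_def by blast
  have "\<exists>p. f i = residue ?X p" if "i < k" for i
    using k(2) that by (intro carrier_coordinate_ringD) auto
  then obtain P where P: "\<And>i. i < k \<Longrightarrow> f i = residue ?X (P i)"
    by metis
  interpret cring ?R by (rule cring_coordinate_ring)
  have "?F = (\<Oplus>\<^bsub>?R\<^esub>i\<in>{..<k}. residue ?X (P i) [^]\<^bsub>?R\<^esub> (2 * n))"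
    unfolding F by (rule finsum_cong') (auto simp: P residue_in_carrier)
  then have "residue ?X (\<Sum>i<k. P i ^ (2 * n)) = residue ?X (\<Sum>l<Suc d. h l ^ (2 * n))"
    by (simp only: residue_power_sum finite_lessThan)
  \<comment> \<open>Evaluation at the parametrized points turns equality of classes into an identity
    in \<open>t\<close>.\<close>
  from eval_mpoly_eq_of_residue_eq[OF this curve_point_in_monomial_curve]
  have eq: "(\<Sum>i<k. eval_mpoly (P i) (curve_point m M t) ^ (2 * n)) =
      (\<Sum>l\<le>d. eval2 (monom (lagrange_basis d l) l) (t ^ m) (t ^ M) ^ (2 * n))" for t
    by (simp add: eval_mpoly_sum eval_mpoly_power h curve_point_def poly_monom poly_const_pow
        lessThan_Suc_atMost mult.commute del: sum.lessThan_Suc)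
  have deg_y: "degree (monom (lagrange_basis d l) l) \<le> d" if "l \<le> d" for l
    using that degree_monom_le order.trans by blast
  have deg_x: "degree (coeff (monom (lagrange_basis d l) l) b) \<le> d" if "l \<le> d" for l b
    using degree_lagrange_basis[OF that] by (auto simp: coeff_monom)
  obtain G where
    "(\<Sum>i<k. G i ^ (2 * n)) = (\<Sum>l\<le>d. monom (lagrange_basis d l) l ^ (2 * n))"
    using power_sum_lifts_to_plane[where H = "\<lambda>l. monom (lagrange_basis d l) l",
        OF n m deg_y deg_x eq] .
  then have "d < k" by (rule lagrange_power_sum_length[OF n])
  then show ?thesis using k(1) by simp
qed

theorem theorem1p3:
  fixes n :: nat and m M :: "nat \<Rightarrow> nat"
  assumes "n \<ge> 1"
    and "\<And>i. 0 < m i" and "\<And>i. m i < M i" and "\<And>i. coprime (m i) (M i)"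
    and "filterlim m at_top sequentially"
  shows "(\<lambda>i. pythagoras_number (coordinate_ring (monomial_curve (m i) (M i))) (2 * n))
    \<longlonglongrightarrow> \<infinity>"
proof (rule order_tendstoI)
  fix a :: enat assume "a < \<infinity>"
  then obtain d where d: "a = enat d" by (cases a) auto
  have "\<forall>\<^sub>F i in sequentially. 4 * n * d < m i"
    using assms(5) unfolding filterlim_at_top Suc_le_eq[symmetric] by blast
  then show "\<forall>\<^sub>F i in sequentially.
      a < pythagoras_number (coordinate_ring (monomial_curve (m i) (M i))) (2 * n)"
  proof eventually_elim
    case (elim i)
    \<comment> \<open>A lower bound on every admissible \<open>g\<close> bounds the infimum, also
      when it is infinite because no \<open>g\<close> is admissible.\<close>
    have "enat (Suc d) \<le> pythagoras_number (coordinate_ring (monomial_curve (m i) (M i))) (2 * n)"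
      unfolding pythagoras_number_def
    proof (rule Inf_greatest)
      fix x
      assume "x \<in> {enat g |g. g > 0 \<and>
        (\<Union>l. power_sums (coordinate_ring (monomial_curve (m i) (M i))) (2 * n) l) \<subseteq>
        power_sums (coordinate_ring (monomial_curve (m i) (M i))) (2 * n) g}"
      then show "enat (Suc d) \<le> x"
        using pythagoras_bound_monomial_curve[OF assms(1) elim assms(3,4)]
        by (auto simp: Suc_le_eq)
    qed
    then show ?case unfolding d by (metis enat_ord_simps(2) less_le_trans lessI)
  qed
qed simp

end
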